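(* Let $n\ge 2$, let $K,L\in\mathcal S^n$ be star bodies in $\mathbb R^n$, let $i$ be an integer with $0\le i<n$, and let $\phi\in\Phi$. Then $$B_{\phi,i}(K,L)\ \ge\ B_i(K)\,\phi\!\left(\left(\frac{B_i(L)}{B_i(K)}\right)^{1/(n-i)}\right).$$ If moreover $\phi$ is strictly convex, then equality holds if and only if $K$ and $L$ have similar chord.
   Context: $S^{n-1}$ is the unit sphere of $\mathbb R^n$ and $dS$ is its spherical Lebesgue measure. For a compact set $K\subset\mathbb R^n$ that contains the origin and is star-shaped with respect to it, the radial function is $\rho(K,u)=\max\{c\ge 0: cu\in K\}$, $u\in S^{n-1}$. $K$ is a star body if $\rho(K,\cdot)$ is positive and continuous on $S^{n-1}$; $\mathcal S^n$ is the set of star bodies. The half chord of $K$ in direction $u$ is $d(K,u)=\tfrac12(\rho(K,u)+\rho(K,-u))$. $K$ and $L$ have similar chord if there is a constant $\lambda>0$ with $d(K,u)=\lambda d(L,u)$ for all $u\in S^{n-1}$. The chord integral is $B_i(K)=\frac1n\int_{S^{n-1}}d(K,u)^{n-i}\,dS(u)$. $\Phi$ is the set of convex functions $\phi:[0,\infty)\to(0,\infty]$, finite on $(0,\infty)$, that are strictly decreasing and satisfy $\phi(0)=\infty$ and $\phi(1)=1$. The Orlicz mixed chord integral is $$B_{\phi,i}(K,L)=\frac1n\int_{S^{n-1}}\phi\!\left(\frac{d(L,u)}{d(K,u)}\right)d(K,u)^{n-i}\,dS(u).$$ *)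

theory Defs
  imports "HOL-Analysis.Analysis"
begin

definition radial :: "'a::euclidean_space set \<Rightarrow> 'a \<Rightarrow> real" where
  "radial K u = (GREATEST c. 0 \<le> c \<and> c *\<^sub>R u \<in> K)"

definition star_body :: "'a::euclidean_space set \<Rightarrow> bool" where
  "star_body K \<longleftrightarrow>
     compact K \<and> 0 \<in> K \<and> (\<forall>x\<in>K. closed_segment 0 x \<subseteq> K) \<and>
     (\<forall>u\<in>sphere 0 1. 0 < radial K u) \<and> continuous_on (sphere 0 1) (radial K)"

definition half_chord :: "'a::euclidean_space set \<Rightarrow> 'a \<Rightarrow> real" where
  "half_chord K u = (radial K u + radial K (- u)) / 2"

definition similar_chord :: "'a::euclidean_space set \<Rightarrow> 'a set \<Rightarrow> bool" where
  "similar_chord K L \<longleftrightarrow>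
     (\<exists>c>0. \<forall>u\<in>sphere 0 1. half_chord K u = c * half_chord L u)"

text \<open>Spherical Lebesgue measure, given by polar coordinates: the measure of a Borel set A
  of unit vectors is n times the volume of the cone over A with apex 0 (see
  \<open>emeasure_sphere_measure\<close> below). With this normalisation the unit sphere has total mass
  n times the volume of the unit ball.\<close>

definition sphere_measure :: "'a::euclidean_space measure" where
  "sphere_measure =
     distr (scale_measure (of_nat DIM('a)) (restrict_space lborel (cball 0 1 - {0})))
       (restrict_space borel (sphere 0 1)) (\<lambda>x. x /\<^sub>R norm x)"

lemma space_sphere_measure: "space (sphere_measure :: 'a::euclidean_space measure) = sphere 0 1"
  by (simp add: sphere_measure_def space_restrict_space)

lemma sets_sphere_measure:
  "sets (sphere_measure :: 'a::euclidean_space measure) = sets (restrict_space borel (sphere 0 1))"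
  by (simp add: sphere_measure_def)

lemma emeasure_sphere_measure:
  fixes A :: "'a::euclidean_space set"
  assumes "A \<in> sets borel" "A \<subseteq> sphere 0 1"
  shows "emeasure sphere_measure A =
    of_nat DIM('a) * emeasure lborel {x \<in> cball 0 1 - {0}. x /\<^sub>R norm x \<in> A}"
proof -
  let ?B = "cball 0 1 - {0::'a}"
  let ?M = "restrict_space lborel ?B"
  have "(\<lambda>x::'a. x /\<^sub>R norm x) \<in> borel_measurable ?M"
    by (intro measurable_restrict_space1) measurable
  then have m: "(\<lambda>x::'a. x /\<^sub>R norm x) \<in> ?M \<rightarrow>\<^sub>M restrict_space borel (sphere 0 1)"
    by (intro measurable_restrict_space2) (auto simp: space_restrict_space)
  have A: "A \<in> sets (restrict_space borel (sphere 0 1))"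
    using assms by (auto simp: sets_restrict_space)
  have pre: "(\<lambda>x. x /\<^sub>R norm x) -` A \<inter> space ?M = {x \<in> ?B. x /\<^sub>R norm x \<in> A}"
    by (auto simp: space_restrict_space)
  have "emeasure sphere_measure A =
      of_nat DIM('a) * emeasure ?M ((\<lambda>x. x /\<^sub>R norm x) -` A \<inter> space ?M)"
    unfolding sphere_measure_def using m A
    by (subst emeasure_distr) (auto simp: measurable_def space_scale_measure)
  also have "\<dots> = of_nat DIM('a) * emeasure lborel {x \<in> ?B. x /\<^sub>R norm x \<in> A}"
    unfolding pre by (subst emeasure_restrict_space) auto
  finally show ?thesis .
qed

definition chord_integral :: "nat \<Rightarrow> (real ^ 'n) set \<Rightarrow> real" where
  "chord_integral i K =
     (1 / real CARD('n)) * (\<integral>u. half_chord K u ^ (CARD('n) - i) \<partial>sphere_measure)"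

text \<open>The values of the functions below at negative arguments are irrelevant. Convexity is
  stated with the arithmetic of the extended half-line, because the value \<open>\<infinity>\<close> occurs at 0.\<close>

definition ext_convex :: "(real \<Rightarrow> ennreal) \<Rightarrow> bool" where
  "ext_convex \<phi> \<longleftrightarrow>
     (\<forall>x\<ge>0. \<forall>y\<ge>0. \<forall>t\<in>{0<..<1}.
        \<phi> ((1 - t) * x + t * y) \<le> ennreal (1 - t) * \<phi> x + ennreal t * \<phi> y)"

definition ext_strictly_convex :: "(real \<Rightarrow> ennreal) \<Rightarrow> bool" where
  "ext_strictly_convex \<phi> \<longleftrightarrow>
     (\<forall>x\<ge>0. \<forall>y\<ge>0. x \<noteq> y \<longrightarrow> (\<forall>t\<in>{0<..<1}.
        \<phi> ((1 - t) * x + t * y) < ennreal (1 - t) * \<phi> x + ennreal t * \<phi> y))"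

definition Phi :: "(real \<Rightarrow> ennreal) set" where
  "Phi = {\<phi>. ext_convex \<phi> \<and> strict_antimono_on {0..} \<phi> \<and>
     (\<forall>x\<ge>0. 0 < \<phi> x) \<and> (\<forall>x>0. \<phi> x < \<infinity>) \<and> \<phi> 0 = \<infinity> \<and> \<phi> 1 = 1}"

definition orlicz_mixed_chord_integral ::
    "(real \<Rightarrow> ennreal) \<Rightarrow> nat \<Rightarrow> (real ^ 'n) set \<Rightarrow> (real ^ 'n) set \<Rightarrow> ennreal" where
  "orlicz_mixed_chord_integral \<phi> i K L =
     ennreal (1 / real CARD('n)) *
       (\<integral>\<^sup>+u. \<phi> (half_chord L u / half_chord K u) *
              ennreal (half_chord K u ^ (CARD('n) - i)) \<partial>sphere_measure)"

end

theory Submission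
  imports Defs
begin

text \<open>Let \<open>p = n - i\<close>, \<open>x = d(L,u) / d(K,u)\<close> and \<open>s\<^sup>p = B\<^sub>i(L) / B\<^sub>i(K)\<close>. A supporting line of the
  decreasing function \<open>\<phi>\<close> at \<open>s\<close> has slope \<open>m \<le> 0\<close>, and Bernoulli's inequality bounds \<open>x - s\<close> by
  a multiple of \<open>x\<^sup>p - s\<^sup>p\<close>. Together they give \<open>\<phi> x \<ge> \<phi> s + k (x\<^sup>p - s\<^sup>p)\<close> with a
  constant \<open>k\<close>. Multiplied by \<open>d(K,u)\<^sup>p\<close> and integrated over the sphere, the last term
  vanishes by the choice of \<open>s\<close>; this replaces both Jensen's and Hoelder's inequality.
  For strictly convex \<open>\<phi>\<close> the pointwise inequality is strict unless \<open>x = s\<close>, and a nonnegative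
  continuous function on the sphere with vanishing integral is zero.\<close>

section \<open>Integrals of continuous functions over the sphere\<close>

lemma finite_measure_sphere_measure: "finite_measure (sphere_measure :: 'a::euclidean_space measure)"
proof
  have "emeasure (sphere_measure :: 'a measure) (sphere 0 1)
      \<le> of_nat DIM('a) * emeasure lborel (cball 0 1 :: 'a set)"
    by (subst emeasure_sphere_measure) (auto intro!: mult_left_mono emeasure_mono)
  also have "\<dots> < \<infinity>"
    using emeasure_bounded_finite[of "cball 0 1 :: 'a set"]
    by (simp add: ennreal_mult_less_top of_nat_less_top)
  finally show "emeasure (sphere_measure :: 'a measure) (space sphere_measure) \<noteq> \<infinity>"
    by (simp add: space_sphere_measure)
qed

lemma borel_measurable_sphere_measure:
  fixes h :: "'a::euclidean_space \<Rightarrow> real"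
  assumes "continuous_on (sphere 0 1) h"
  shows "h \<in> borel_measurable sphere_measure"
  using borel_measurable_continuous_on_restrict[OF assms]
  by (simp add: measurable_cong_sets[OF sets_sphere_measure refl])

lemma integrable_sphere_measure:
  fixes h :: "'a::euclidean_space \<Rightarrow> real"
  assumes "continuous_on (sphere 0 1) h"
  shows "integrable sphere_measure h"
proof -
  interpret finite_measure "sphere_measure :: 'a measure"
    by (rule finite_measure_sphere_measure)
  have "bounded (h ` sphere 0 1)"
    by (intro compact_imp_bounded compact_continuous_image assms compact_sphere)
  then obtain B where "\<And>u. u \<in> sphere 0 1 \<Longrightarrow> norm (h u) \<le> B"
    unfolding bounded_iff by blast
  then show ?thesis
    by (intro integrable_const_bound[of _ B] borel_measurable_sphere_measure[OF assms] AE_I2)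
      (simp add: space_sphere_measure)
qed

text \<open>The cone over the set where \<open>h\<close> is nonzero, cut off by the open unit ball
  and without its apex, is open and nonempty. Such a set cannot be Lebesgue negligible.\<close>

lemma emeasure_sphere_measure_pos:
  fixes h :: "'a::euclidean_space \<Rightarrow> real"
  assumes cont: "continuous_on (sphere 0 1) h" and v: "v \<in> sphere 0 1" "h v \<noteq> 0"
  shows "emeasure sphere_measure {u \<in> sphere 0 1. h u \<noteq> 0} \<noteq> 0"
proof
  let ?A = "{u \<in> sphere 0 1. h u \<noteq> 0}"
  let ?B = "ball 0 1 - {0::'a}"
  let ?U = "{x \<in> ?B. x /\<^sub>R norm x \<in> ?A}"
  assume "emeasure sphere_measure ?A = 0"
  moreover have "{u \<in> space sphere_measure. h u \<noteq> 0} \<in> sets sphere_measure"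
    using borel_measurable_sphere_measure[OF cont] by measurable
  then have A: "?A \<in> sets borel"
    by (auto simp: space_sphere_measure sets_sphere_measure sets_restrict_space)
  ultimately have "emeasure lborel {x \<in> cball 0 1 - {0::'a}. x /\<^sub>R norm x \<in> ?A} = 0" (is "emeasure _ ?C = 0")
    by (subst (asm) emeasure_sphere_measure) auto
  moreover have "?C \<in> sets borel"
  proof -
    have "{x \<in> space borel. x /\<^sub>R norm x \<in> ?A} \<in> sets borel"
      using A by measurable
    moreover have "?C = {x \<in> space borel. x /\<^sub>R norm x \<in> ?A} \<inter> (cball 0 1 - {0})"
      by auto
    ultimately show ?thesis by simp
  qed
  ultimately have "?C \<in> null_sets lborel"
    by (intro null_setsI) (simp_all only: sets_lborel)
  then have "negligible ?C"
    by (simp add: negligible_iff_null_sets null_sets_completionI)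
  then have "negligible ?U"
    by (rule negligible_subset) auto
  moreover have "open ?U"
  proof -
    \<comment> \<open>Normalisation is continuous away from the origin, so \<open>h\<close> extends
      continuously along rays.\<close>
    have "continuous_on ?B (\<lambda>x. h (x /\<^sub>R norm x))"
    proof (rule continuous_on_compose2[OF cont])
      show "continuous_on ?B (\<lambda>x. x /\<^sub>R norm x)"
        by (intro continuous_intros) auto
    qed (auto, metis left_inverse norm_eq_zero)
    then have "open (?B \<inter> (\<lambda>x. h (x /\<^sub>R norm x)) -` (- {0}))"
      by (intro continuous_open_preimage) auto
    also have "?B \<inter> (\<lambda>x. h (x /\<^sub>R norm x)) -` (- {0}) = ?U"
      by auto
    finally show ?thesis .
  qed
  \<comment> \<open>Halving \<open>v\<close> moves it into the open ball and keeps its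
    direction.\<close>
  moreover have "v /\<^sub>R 2 \<in> ?U"
    using v by auto
  ultimately show False
    using open_not_negligible by blast
qed

text \<open>A vanishing integral only gives \<open>h u = 0\<close> almost everywhere; continuity
  improves this to everywhere, which the equality case requires.\<close>

lemma integral_sphere_measure_eq_0_iff:
  fixes h :: "'a::euclidean_space \<Rightarrow> real"
  assumes cont: "continuous_on (sphere 0 1) h" and nonneg: "\<And>u. u \<in> sphere 0 1 \<Longrightarrow> 0 \<le> h u"
  shows "(\<integral>u. h u \<partial>sphere_measure) = 0 \<longleftrightarrow> (\<forall>u\<in>sphere 0 1. h u = 0)"
proof
  assume "(\<integral>u. h u \<partial>sphere_measure) = 0"
  then have "AE u in sphere_measure. h u = 0"
    using nonneg
    by (subst (asm) integral_nonneg_eq_0_iff_AE[OF integrable_sphere_measure[OF cont]])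
      (auto simp: space_sphere_measure)
  then have "emeasure sphere_measure {u \<in> space sphere_measure. h u \<noteq> 0} = 0"
    using borel_measurable_sphere_measure[OF cont] by (subst (asm) AE_iff_measurable[OF _ refl]) measurable
  then show "\<forall>u\<in>sphere 0 1. h u = 0"
    using emeasure_sphere_measure_pos[OF cont] unfolding space_sphere_measure by blast
next
  assume "\<forall>u\<in>sphere 0 1. h u = 0"
  then have "(\<integral>u. h u \<partial>sphere_measure) = (\<integral>u. 0 \<partial>(sphere_measure :: 'a measure))"
    by (intro Bochner_Integration.integral_cong) (auto simp: space_sphere_measure)
  then show "(\<integral>u. h u \<partial>sphere_measure) = 0" by simp
qed

lemma integral_sphere_measure_pos:
  fixes h :: "'a::euclidean_space \<Rightarrow> real"
  assumes cont: "continuous_on (sphere 0 1) h" and pos: "\<And>u. u \<in> sphere 0 1 \<Longrightarrow> 0 < h u"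
  shows "(\<integral>u. h u \<partial>sphere_measure) > 0"
proof -
  have "0 \<le> (\<integral>u. h u \<partial>sphere_measure)"
    by (intro integral_nonneg_AE AE_I2) (auto simp: space_sphere_measure intro: less_imp_le[OF pos])
  moreover obtain e :: 'a where "e \<in> Basis"
    using nonempty_Basis by blast
  then have "\<not> (\<forall>u\<in>sphere 0 1. h u = 0)"
    using pos[of e] by (auto intro!: bexI[of _ e])
  then have "(\<integral>u. h u \<partial>sphere_measure) \<noteq> 0"
    using integral_sphere_measure_eq_0_iff[OF cont] less_imp_le[OF pos] by blast
  ultimately show ?thesis by simp
qed

section \<open>Half chords\<close>

lemma half_chord_pos: "star_body K \<Longrightarrow> u \<in> sphere 0 1 \<Longrightarrow> 0 < half_chord K u"
  by (auto simp: star_body_def half_chord_def intro!: add_pos_pos)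

lemma continuous_on_half_chord:
  assumes "star_body K"
  shows "continuous_on (sphere 0 1) (half_chord K)"
proof -
  have c: "continuous_on (sphere 0 1) (radial K)"
    using assms by (simp add: star_body_def)
  have "continuous_on (sphere 0 1) (\<lambda>u. radial K (- u))"
    by (rule continuous_on_compose2[OF c]) (auto intro: continuous_on_minus continuous_on_id)
  with c show ?thesis
    unfolding half_chord_def by (intro continuous_on_divide continuous_on_add continuous_on_const) auto
qed

section \<open>Supporting lines\<close>

text \<open>Ratios of half chords of star bodies are positive, so only the finite part of
  \<open>\<phi>\<close> matters and real analysis applies to \<open>\<psi>\<close>. Strict convexity
  is kept at midpoints only, which suffices for the equality case.\<close>

lemma Phi_real:
  assumes "\<phi> \<in> Phi"
  obtains \<psi> where "\<And>x. 0 < x \<Longrightarrow> \<phi> x = ennreal (\<psi> x)" "\<And>x. 0 < x \<Longrightarrow> 0 < \<psi> x"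
    "convex_on {0<..} \<psi>" "\<And>x y. 0 < x \<Longrightarrow> x < y \<Longrightarrow> \<psi> y < \<psi> x"
    "\<And>x y. ext_strictly_convex \<phi> \<Longrightarrow> 0 < x \<Longrightarrow> 0 < y \<Longrightarrow> x \<noteq> y \<Longrightarrow> \<psi> ((x + y) / 2) < (\<psi> x + \<psi> y) / 2"
proof -
  define \<psi> where "\<psi> x = enn2real (\<phi> x)" for x
  have eq: "\<phi> x = ennreal (\<psi> x)" if "0 < x" for x
    using that assms by (simp add: \<psi>_def Phi_def less_top)
  have pos: "0 < \<psi> x" if "0 < x" for x
    using that assms by (simp add: \<psi>_def Phi_def enn2real_positive_iff less_top)
  have comb: "ennreal (1 - t) * \<phi> x + ennreal t * \<phi> y = ennreal ((1 - t) * \<psi> x + t * \<psi> y)"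
    if "0 < x" "0 < y" "t \<in> {0<..<1}" for x y t
    using that pos[of x] pos[of y] by (simp add: eq ennreal_mult ennreal_plus)
  have conv: "convex_on {0<..} \<psi>"
  proof (rule convex_onI)
    fix t x y :: real
    assume a: "0 < t" "t < 1" "x \<in> {0<..}" "y \<in> {0<..}"
    then have z: "0 < (1 - t) * x + t * y"
      by (auto intro!: add_pos_pos)
    have "\<phi> ((1 - t) * x + t * y) \<le> ennreal (1 - t) * \<phi> x + ennreal t * \<phi> y"
      using assms a by (auto simp: Phi_def ext_convex_def)
    also have "\<dots> = ennreal ((1 - t) * \<psi> x + t * \<psi> y)"
      using a by (intro comb) auto
    finally have "\<phi> ((1 - t) * x + t * y) \<le> ennreal ((1 - t) * \<psi> x + t * \<psi> y)" .
    \<comment> \<open>\<open>ennreal\<close> sends negative numbers to 0, so the inequality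
      transfers to the reals only once the right-hand side is known to be nonnegative.\<close>
    moreover have "0 \<le> (1 - t) * \<psi> x + t * \<psi> y"
      using a pos[of x] pos[of y] by simp
    ultimately show "\<psi> ((1 - t) *\<^sub>R x + t *\<^sub>R y) \<le> (1 - t) * \<psi> x + t * \<psi> y"
      using a z by (simp add: eq ennreal_le_iff)
  qed (simp add: convex_real_interval)
  have anti: "\<psi> y < \<psi> x" if "0 < x" "x < y" for x y
  proof -
    have "\<phi> y < \<phi> x"
      using assms that by (auto simp: Phi_def monotone_on_def)
    then show ?thesis
      using that pos[of y] by (simp add: eq ennreal_less_iff)
  qed
  have strict: "\<psi> ((x + y) / 2) < (\<psi> x + \<psi> y) / 2"
    if "ext_strictly_convex \<phi>" "0 < x" "0 < y" "x \<noteq> y" for x y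
  proof -
    have "\<phi> ((1 - 1/2) * x + 1/2 * y) < ennreal (1 - 1/2) * \<phi> x + ennreal (1/2) * \<phi> y"
      using that(1)[unfolded ext_strictly_convex_def, rule_format, of x y "1/2"] that by simp
    also have "\<dots> = ennreal ((1 - 1/2) * \<psi> x + 1/2 * \<psi> y)"
      using that by (intro comb) auto
    also have "(1 - 1/2) * \<psi> x + 1/2 * \<psi> y = (\<psi> x + \<psi> y) / 2"
      by simp
    also have "(1 - 1/2) * x + 1/2 * y = (x + y) / 2"
      by simp
    finally show ?thesis
      using that pos[of "(x + y) / 2"] by (simp add: eq ennreal_less_iff)
  qed
  show thesis
    by (rule that[OF eq pos conv anti strict])
qed

lemma supporting_slope_decreasing:
  fixes \<psi> :: "real \<Rightarrow> real"
  assumes conv: "convex_on {0<..} \<psi>" and anti: "\<And>x y. 0 < x \<Longrightarrow> x < y \<Longrightarrow> \<psi> y < \<psi> x" and s: "0 < s"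
  obtains m where "m \<le> 0" "\<And>x. 0 < x \<Longrightarrow> \<psi> s + m * (x - s) \<le> \<psi> x"
proof -
  \<comment> \<open>The infimum of the secant slopes to the right of \<open>s\<close>, that is, the
    right derivative of \<open>\<psi>\<close> at \<open>s\<close>.\<close>
  define m where "m = Inf ((\<lambda>t. (\<psi> s - \<psi> t) / (s - t)) ` ({s<..} \<inter> {0<..}))"
  have m: "\<psi> s + m * (x - s) \<le> \<psi> x" if "0 < x" for x
    using convex_le_Inf_differential[OF conv, of s x] s that by (simp add: m_def interior_open)
  show thesis
    \<comment> \<open>At \<open>s + 1\<close> the line lies at height \<open>\<psi> s + m\<close>,
      which is at most \<open>\<psi> (s + 1) < \<psi> s\<close>; this gives the sign of
      \<open>m\<close>.\<close>
    using m[of "s + 1"] anti[of s "s + 1"] s by (intro that[OF _ m]) auto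
qed

text \<open>Bernoulli's inequality for \<open>x / s - 1 \<ge> -1\<close>, scaled by
  \<open>s ^ p\<close>. The case \<open>p = 0\<close> is separate because \<open>p - 1\<close> is
  then truncated.\<close>

lemma power_ge_tangent:
  fixes x s :: real
  assumes "0 \<le> x" "0 < s"
  shows "s ^ p + real p * s ^ (p - 1) * (x - s) \<le> x ^ p"
proof (cases p)
  case (Suc q)
  have "1 + real p * (x / s - 1) \<le> (1 + (x / s - 1)) ^ p"
    using assms by (intro Bernoulli_inequality) simp
  then have "s ^ p * (1 + real p * (x / s - 1)) \<le> s ^ p * (x / s) ^ p"
    using assms by (intro mult_left_mono) auto
  also have "s ^ p * (x / s) ^ p = x ^ p"
    using assms by (simp add: power_divide)
  also have "s ^ p * (1 + real p * (x / s - 1)) = s ^ p + real p * s ^ (p - 1) * (x - s)"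
    using assms by (simp add: Suc field_simps)
  finally show ?thesis .
qed simp

section \<open>Integration of the pointwise bound and the equality case\<close>

theorem theorem5p4:
  fixes K L :: "(real ^ 'n) set" and i :: nat and \<phi> :: "real \<Rightarrow> ennreal"
  assumes "CARD('n) \<ge> 2"
    and "star_body K" and "star_body L"
    and "i < CARD('n)"
    and "\<phi> \<in> Phi"
  shows "orlicz_mixed_chord_integral \<phi> i K L
           \<ge> ennreal (chord_integral i K) *
              \<phi> ((chord_integral i L / chord_integral i K) powr (1 / real (CARD('n) - i)))
       \<and> (ext_strictly_convex \<phi> \<longrightarrow>
            (orlicz_mixed_chord_integral \<phi> i K L
               = ennreal (chord_integral i K) *
                 \<phi> ((chord_integral i L / chord_integral i K) powr (1 / real (CARD('n) - i)))
             \<longleftrightarrow> similar_chord K L))"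
proof -
  obtain \<psi> where \<psi>: "\<And>x. 0 < x \<Longrightarrow> \<phi> x = ennreal (\<psi> x)" "\<And>x. 0 < x \<Longrightarrow> 0 < \<psi> x"
    and conv: "convex_on {0<..} \<psi>" and anti: "\<And>x y. 0 < x \<Longrightarrow> x < y \<Longrightarrow> \<psi> y < \<psi> x"
    and strict: "\<And>x y. ext_strictly_convex \<phi> \<Longrightarrow> 0 < x \<Longrightarrow> 0 < y \<Longrightarrow> x \<noteq> y \<Longrightarrow>
      \<psi> ((x + y) / 2) < (\<psi> x + \<psi> y) / 2"
    by (rule Phi_real[OF assms(5)]) (rule that)
  define p where "p = CARD('n) - i"
  have p: "p > 0" using assms(4) by (simp add: p_def)
  define a where "a = half_chord K"
  define b where "b = half_chord L"
  define S where "S = (sphere 0 1 :: (real ^ 'n) set)"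
  have a: "0 < a u" and b: "0 < b u" if "u \<in> S" for u
    using that half_chord_pos assms(2,3) by (auto simp: a_def b_def S_def)
  have ca: "continuous_on S a" and cb: "continuous_on S b"
    using continuous_on_half_chord assms(2,3) by (auto simp: a_def b_def S_def)
  define A where "A = (\<integral>u. a u ^ p \<partial>sphere_measure)"
  define B where "B = (\<integral>u. b u ^ p \<partial>sphere_measure)"
  have A: "0 < A" and B: "0 < B"
    using a b ca cb unfolding A_def B_def S_def
    by (auto intro!: integral_sphere_measure_pos continuous_intros)
  define s where "s = (B / A) powr (1 / real p)"
  have s: "0 < s" using A B by (simp add: s_def)
  have sp: "s ^ p = B / A"
    using A B p by (simp add: s_def powr_powr flip: powr_realpow)
  have K_eq: "chord_integral i K = A / CARD('n)" and L_eq: "chord_integral i L = B / CARD('n)"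
    by (simp_all add: chord_integral_def A_def B_def a_def b_def p_def)
  have s_eq: "(chord_integral i L / chord_integral i K) powr (1 / real (CARD('n) - i)) = s"
    by (simp add: K_eq L_eq s_def p_def)
  obtain m where m: "m \<le> 0" "\<And>x. 0 < x \<Longrightarrow> \<psi> s + m * (x - s) \<le> \<psi> x"
    using supporting_slope_decreasing[OF conv anti s] by blast
  \<comment> \<open>The slope \<open>m\<close> divided by the derivative of \<open>x ^ p\<close> at
    \<open>s\<close>, so that \<open>k * (x ^ p - s ^ p)\<close> has the tangent
    \<open>m * (x - s)\<close> there. As \<open>k \<le> 0\<close>, the tangent inequality for the
    power is reversed below.\<close>
  define k where "k = m / (real p * s ^ (p - 1))"
  have k: "k * (x ^ p - s ^ p) \<le> m * (x - s)" if "0 < x" for x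
  proof -
    have "real p * s ^ (p - 1) * (x - s) \<le> x ^ p - s ^ p"
      using power_ge_tangent[of x s p] that s by simp
    then have "k * (x ^ p - s ^ p) \<le> k * (real p * s ^ (p - 1) * (x - s))"
      using m(1) s by (intro mult_left_mono_neg) (auto simp: k_def divide_nonpos_nonneg)
    also have "\<dots> = m * (x - s)"
      using s p by (simp add: k_def)
    finally show ?thesis .
  qed
  define x where "x u = b u / a u" for u
  have x: "0 < x u" if "u \<in> S" for u
    using a b that by (simp add: x_def)
  have cx: "continuous_on S x"
    unfolding x_def using a by (force intro!: continuous_intros ca cb)
  have c\<psi>: "continuous_on S (\<lambda>u. \<psi> (x u))"
    by (rule continuous_on_compose2[OF convex_on_continuous[OF _ conv] cx]) (auto simp: x)
  define g where "g u = \<psi> (x u) * a u ^ p" for u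
  have cg: "continuous_on S g"
    unfolding g_def by (intro continuous_intros ca c\<psi>)
  \<comment> \<open>The defect of the pointwise bound, weighted by \<open>a u ^ p\<close>. Written
    with \<open>b u ^ p\<close> in place of \<open>x u ^ p * a u ^ p\<close>, it integrates termwise
    to \<open>G\<close>, \<open>A\<close> and \<open>B\<close>.\<close>
  define q where "q u = g u - \<psi> s * a u ^ p - k * (b u ^ p - s ^ p * a u ^ p)" for u
  have cq: "continuous_on S q"
    unfolding q_def by (intro continuous_intros ca cb cg)
  have q_eq: "q u = a u ^ p * (\<psi> (x u) - \<psi> s - k * (x u ^ p - s ^ p))" if "u \<in> S" for u
  proof -
    have "b u ^ p = x u ^ p * a u ^ p"
      using a[OF that] by (simp add: x_def power_divide)
    then show ?thesis by (simp add: q_def g_def algebra_simps)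
  qed
  \<comment> \<open>The bracket is the sum of two nonnegative gaps: \<open>\<psi>\<close> above its
    supporting line, and \<open>m * (x u - s)\<close> above
    \<open>k * (x u ^ p - s ^ p)\<close>.\<close>
  have q: "0 \<le> q u" if "u \<in> S" for u
    unfolding q_eq[OF that] using m(2)[OF x[OF that]] k[OF x[OF that]] a[OF that]
    by (intro mult_nonneg_nonneg) auto
  have q0: "q u = 0 \<longleftrightarrow> x u = s" if u: "u \<in> S" and sc: "ext_strictly_convex \<phi>" for u
  proof
    assume "q u = 0"
    then have eq: "\<psi> (x u) \<le> \<psi> s + m * (x u - s)"
      using k[OF x[OF u]] a[OF u] by (simp add: q_eq[OF u])
    \<comment> \<open>By \<open>eq\<close>, the chord of \<open>\<psi>\<close> between
      \<open>s\<close> and \<open>x u\<close> lies on or below the supporting line. At the midpoint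
      strict convexity would put \<open>\<psi>\<close> below that line.\<close>
    show "x u = s"
    proof (rule ccontr)
      assume "x u \<noteq> s"
      then have "\<psi> ((x u + s) / 2) < (\<psi> (x u) + \<psi> s) / 2"
        using strict[OF sc x[OF u] s] by simp
      moreover have "\<psi> s + m * ((x u + s) / 2 - s) \<le> \<psi> ((x u + s) / 2)"
        using x[OF u] s by (intro m(2)) simp
      ultimately show False
        using eq by (simp add: field_simps)
    qed
  qed (simp add: q_eq[OF u])
  define G where "G = (\<integral>u. g u \<partial>sphere_measure)"
  have int: "integrable sphere_measure h" if "continuous_on S h" for h :: "real ^ 'n \<Rightarrow> real"
    using integrable_sphere_measure that by (simp add: S_def)
  have int_abg: "integrable sphere_measure (\<lambda>u. a u ^ p)" "integrable sphere_measure (\<lambda>u. b u ^ p)"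
      "integrable sphere_measure g"
    by (intro int continuous_intros ca cb cg)+
  have "(\<integral>u. q u \<partial>sphere_measure) = G - \<psi> s * A - k * (B - s ^ p * A)"
    unfolding q_def G_def A_def B_def using int_abg by simp
  \<comment> \<open>The choice of \<open>s\<close> makes \<open>B - s ^ p * A\<close> vanish, so
    \<open>k\<close> disappears.\<close>
  then have Q: "(\<integral>u. q u \<partial>sphere_measure) = G - \<psi> s * A"
    using A by (simp add: sp)
  have Q_nonneg: "0 \<le> (\<integral>u. q u \<partial>sphere_measure)"
    using q by (intro integral_nonneg_AE AE_I2) (auto simp: space_sphere_measure S_def)
  have Q_0: "(\<integral>u. q u \<partial>sphere_measure) = 0 \<longleftrightarrow> (\<forall>u\<in>S. q u = 0)"
    using integral_sphere_measure_eq_0_iff[of q] cq q by (simp add: S_def)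
  have g_nonneg: "0 \<le> g u" if "u \<in> S" for u
    using a[OF that] \<psi>(2)[OF x[OF that]] by (simp add: g_def)
  have G: "0 \<le> G"
    unfolding G_def using g_nonneg by (intro integral_nonneg_AE AE_I2) (auto simp: space_sphere_measure S_def)
  have "(\<integral>\<^sup>+u. \<phi> (half_chord L u / half_chord K u) *
              ennreal (half_chord K u ^ (CARD('n) - i)) \<partial>sphere_measure)
      = (\<integral>\<^sup>+u. ennreal (g u) \<partial>sphere_measure)"
  proof (rule nn_integral_cong)
    fix u :: "real ^ 'n" assume "u \<in> space sphere_measure"
    then have u: "u \<in> S" by (simp add: S_def space_sphere_measure)
    show "\<phi> (half_chord L u / half_chord K u) * ennreal (half_chord K u ^ (CARD('n) - i)) = ennreal (g u)"
      using \<psi>[OF x[OF u]] a[OF u] by (simp add: g_def x_def a_def b_def p_def ennreal_mult)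
  qed
  also have "\<dots> = ennreal G"
    unfolding G_def using g_nonneg
    by (intro nn_integral_eq_integral int_abg AE_I2) (auto simp: space_sphere_measure S_def)
  finally have lhs: "orlicz_mixed_chord_integral \<phi> i K L = ennreal (G / CARD('n))"
    using G by (simp add: orlicz_mixed_chord_integral_def flip: ennreal_mult)
  have rhs: "ennreal (chord_integral i K) * \<phi> s = ennreal (\<psi> s * A / CARD('n))"
    using A \<psi>[OF s] by (simp add: K_eq mult.commute flip: ennreal_mult)
  have nonneg: "0 \<le> \<psi> s * A"
    using A \<psi>(2)[OF s] by simp
  have "ennreal (chord_integral i K) * \<phi> s \<le> orlicz_mixed_chord_integral \<phi> i K L"
    using Q Q_nonneg unfolding lhs rhs by (intro ennreal_leI divide_right_mono) auto
  moreover have "orlicz_mixed_chord_integral \<phi> i K L = ennreal (chord_integral i K) * \<phi> s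
      \<longleftrightarrow> similar_chord K L" if sc: "ext_strictly_convex \<phi>"
  proof -
    have "orlicz_mixed_chord_integral \<phi> i K L = ennreal (chord_integral i K) * \<phi> s
        \<longleftrightarrow> (\<integral>u. q u \<partial>sphere_measure) = 0"
      \<comment> \<open>Both sides are nonnegative reals, on which \<open>ennreal\<close> is
        injective.\<close>
      unfolding lhs rhs using G nonneg by (simp add: ennreal_inj Q)
    also have "\<dots> \<longleftrightarrow> (\<forall>u\<in>S. x u = s)"
      using Q_0 q0[OF _ sc] by blast
    also have "\<dots> \<longleftrightarrow> similar_chord K L"
    proof
      assume eq: "\<forall>u\<in>S. x u = s"
      have "a u = 1 / s * b u" if "u \<in> S" for u
        using eq a[OF that] s that by (auto simp: x_def field_simps)
      then show "similar_chord K L"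
        using s by (auto simp: similar_chord_def a_def b_def S_def intro!: exI[of _ "1 / s"])
    next
      assume "similar_chord K L"
      then obtain c where c: "c > 0" "\<And>u. u \<in> S \<Longrightarrow> a u = c * b u"
        by (auto simp: similar_chord_def a_def b_def S_def)
      \<comment> \<open>Proportional half chords determine the mean ratio:
        \<open>A = c ^ p * B\<close> forces \<open>s = 1 / c\<close>, which is also the constant
        value of \<open>x\<close>.\<close>
      have "A = (\<integral>u. c ^ p * b u ^ p \<partial>sphere_measure)"
        unfolding A_def using c(2)
        by (intro Bochner_Integration.integral_cong) (auto simp: space_sphere_measure S_def power_mult_distrib)
      then have "A = c ^ p * B"
        by (simp add: B_def)
      then have "s ^ p = (1 / c) ^ p"
        using B by (simp add: sp power_divide)
      then have "s = 1 / c"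
        using s c(1) p by (auto intro: power_eq_imp_eq_base)
      then show "\<forall>u\<in>S. x u = s"
        using c b by (fastforce simp: x_def)
    qed
    finally show ?thesis .
  qed
  ultimately show ?thesis
    unfolding s_eq by blast
qed

end
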